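(* Let $H$ be a connected graph with diameter at least $5$. Then for all $n \in \mathbb{N}$, $\mathrm{sat}^\ast(n,H)\ge n-1$.
   Context: All graphs are finite and simple. An edge-colouring of a graph is proper if any two distinct edges sharing a vertex receive different colours; a subgraph is rainbow if all its edges receive distinct colours. A rainbow copy of $H$ in an edge-coloured graph $G$ is a subgraph of $G$ isomorphic to $H$ all of whose edges have distinct colours. A graph $G$ is properly rainbow $H$-saturated if (1) there is a proper edge-colouring of $G$ containing no rainbow copy of $H$, and (2) for every non-edge $e \notin E(G)$ (a pair of distinct non-adjacent vertices of $G$), every proper edge-colouring of $G+e$ contains a rainbow copy of $H$. The proper rainbow saturation number $\mathrm{sat}^\ast(n,H)$ is the minimum number of edges in a properly rainbow $H$-saturated graph on $n$ vertices. The diameter of a graph $G$ is $\max\{d_G(u,v): u,v\in V(G)\}$, where $d_G(u,v)$ is the number of edges in a shortest path from $u$ to $v$. *)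

theory Defs
  imports Main
begin

datatype 'a ugraph = Graph (gverts: "'a set") (gedges: "'a set set")

definition simple_graph :: "'a ugraph \<Rightarrow> bool" where
  "simple_graph G \<longleftrightarrow> finite (gverts G) \<and>
     gedges G \<subseteq> {{u, v} | u v. u \<in> gverts G \<and> v \<in> gverts G \<and> u \<noteq> v}"

definition is_path :: "'a ugraph \<Rightarrow> 'a \<Rightarrow> 'a list \<Rightarrow> 'a \<Rightarrow> bool" where
  "is_path G u p v \<longleftrightarrow> p \<noteq> [] \<and> hd p = u \<and> last p = v \<and> set p \<subseteq> gverts G \<and> distinct p \<and>
     successively (\<lambda>x y. {x, y} \<in> gedges G) p"

text \<open>The graph without vertices does not count as connected; its diameter would be the
  maximum of the empty set.\<close>

definition graph_connected :: "'a ugraph \<Rightarrow> bool" where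
  "graph_connected G \<longleftrightarrow> gverts G \<noteq> {} \<and>
     (\<forall>u \<in> gverts G. \<forall>v \<in> gverts G. \<exists>p. is_path G u p v)"

text \<open>A path is given by its list of vertices, so a path with \<open>k\<close> edges has length \<open>Suc k\<close>.
  Distance and diameter are only meaningful for connected graphs.\<close>

definition graph_dist :: "'a ugraph \<Rightarrow> 'a \<Rightarrow> 'a \<Rightarrow> nat" where
  "graph_dist G u v = (LEAST k. \<exists>p. is_path G u p v \<and> length p = Suc k)"

definition graph_diameter :: "'a ugraph \<Rightarrow> nat" where
  "graph_diameter G = Max {graph_dist G u v | u v. u \<in> gverts G \<and> v \<in> gverts G}"

definition is_subgraph :: "'a ugraph \<Rightarrow> 'a ugraph \<Rightarrow> bool" where
  "is_subgraph K G \<longleftrightarrow> simple_graph K \<and> gverts K \<subseteq> gverts G \<and> gedges K \<subseteq> gedges G"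

definition graph_isomorphic :: "'a ugraph \<Rightarrow> 'b ugraph \<Rightarrow> bool" where
  "graph_isomorphic H K \<longleftrightarrow> (\<exists>f. bij_betw f (gverts H) (gverts K) \<and>
     (\<forall>u \<in> gverts H. \<forall>v \<in> gverts H. {u, v} \<in> gedges H \<longleftrightarrow> {f u, f v} \<in> gedges K))"

definition proper_edge_colouring :: "'a ugraph \<Rightarrow> ('a set \<Rightarrow> 'c) \<Rightarrow> bool" where
  "proper_edge_colouring G c \<longleftrightarrow>
     (\<forall>e \<in> gedges G. \<forall>f \<in> gedges G. e \<noteq> f \<and> e \<inter> f \<noteq> {} \<longrightarrow> c e \<noteq> c f)"

definition rainbow :: "('a set \<Rightarrow> 'c) \<Rightarrow> 'a ugraph \<Rightarrow> bool" where
  "rainbow c K \<longleftrightarrow> inj_on c (gedges K)"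

definition has_rainbow_copy :: "('a set \<Rightarrow> 'c) \<Rightarrow> 'a ugraph \<Rightarrow> 'b ugraph \<Rightarrow> bool" where
  "has_rainbow_copy c G H \<longleftrightarrow>
     (\<exists>K. is_subgraph K G \<and> graph_isomorphic H K \<and> rainbow c K)"

definition add_edge :: "'a ugraph \<Rightarrow> 'a set \<Rightarrow> 'a ugraph" where
  "add_edge G e = Graph (gverts G) (insert e (gedges G))"

text \<open>Colours are natural numbers. As the graphs are finite, this is no restriction on the
  set of colours.\<close>

definition properly_rainbow_saturated :: "'b ugraph \<Rightarrow> 'a ugraph \<Rightarrow> bool" where
  "properly_rainbow_saturated H G \<longleftrightarrow> simple_graph G \<and>
     (\<exists>c :: 'a set \<Rightarrow> nat. proper_edge_colouring G c \<and> \<not> has_rainbow_copy c G H) \<and>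
     (\<forall>u \<in> gverts G. \<forall>v \<in> gverts G. u \<noteq> v \<and> {u, v} \<notin> gedges G \<longrightarrow>
        (\<forall>c :: 'a set \<Rightarrow> nat. proper_edge_colouring (add_edge G {u, v}) c \<longrightarrow>
           has_rainbow_copy c (add_edge G {u, v}) H))"

text \<open>Every finite graph is isomorphic to one whose vertices are natural numbers. The minimum
  exists as soon as \<open>H\<close> has an edge: any edge-maximal graph on \<open>n\<close> vertices that has
  a proper edge-colouring without a rainbow copy of \<open>H\<close> is saturated.\<close>

definition sat_star :: "nat \<Rightarrow> 'b ugraph \<Rightarrow> nat" where
  "sat_star n H = (LEAST m. \<exists>G :: nat ugraph.
     properly_rainbow_saturated H G \<and> card (gverts G) = n \<and> card (gedges G) = m)"

end

theory Submission
  imports Defs "HOL-Combinatorics.Transposition"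
begin

text \<open>Call a leaf \<open>u\<close> pendant if its neighbour has at most one neighbour that is not
  a leaf. A union of components without pendant vertices has at least as many edges as vertices,
  so it suffices that all pendant vertices of a saturated graph lie in one component. Let \<open>u\<close>,
  \<open>v\<close> be pendant vertices in different components, and take a proper colouring without a rainbow
  copy of \<open>H\<close>. Permute the colours outside the component of \<open>u\<close> so that the edges at \<open>u\<close> and at
  \<open>v\<close> get the same colour, and so do the edges through which one leaves the two stars around their
  neighbours; give \<open>uv\<close> the latter colour. A rainbow copy of \<open>H\<close> through \<open>uv\<close> cannot leave the
  stars and continues beyond only one of \<open>u\<close>, \<open>v\<close>; all its vertices are within distance two of
  that one, so the diameter is at most four.\<close>

section \<open>Adjacency, paths and the diameter\<close>

text \<open>As a relation, adjacency expresses components by \<open>(adj G)\<^sup>*\<close> and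
  distance at most \<open>k\<close> by \<open>(adj G)\<^sup>= ^^ k\<close>.\<close>

definition adj :: "'a ugraph \<Rightarrow> ('a \<times> 'a) set" where
  "adj G = {(x, y). {x, y} \<in> gedges G}"

lemma in_adj [simp]: "(x, y) \<in> adj G \<longleftrightarrow> {x, y} \<in> gedges G"
  by (simp add: adj_def)

lemma sym_adj: "sym (adj G)"
  by (auto simp: sym_def insert_commute)

lemma simple_graph_edgeD:
  assumes "simple_graph G" "{x, y} \<in> gedges G"
  shows "x \<in> gverts G" "y \<in> gverts G" "x \<noteq> y"
  using assms by (fastforce simp: simple_graph_def doubleton_eq_iff)+

lemma simple_graph_edgeE:
  assumes "simple_graph G" "e \<in> gedges G"
  obtains x y where "e = {x, y}" "x \<in> gverts G" "y \<in> gverts G" "x \<noteq> y"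
  using assms by (fastforce simp: simple_graph_def)

lemma finite_gedges: "simple_graph G \<Longrightarrow> finite (gedges G)"
  by (rule finite_subset[of _ "Pow (gverts G)"]) (auto simp: simple_graph_def)

lemma simple_graph_add_edge:
  assumes "simple_graph G" "u \<in> gverts G" "v \<in> gverts G" "u \<noteq> v"
  shows "simple_graph (add_edge G {u, v})"
  using assms by (auto simp: simple_graph_def add_edge_def)

lemma is_path_imp_rtrancl: "is_path G x p y \<Longrightarrow> (x, y) \<in> (adj G)\<^sup>*"
proof (induction p arbitrary: x)
  case (Cons a p)
  show ?case
  proof (cases "p = []")
    case False
    then have "is_path G (hd p) p y" and "(x, hd p) \<in> adj G"
      using Cons.prems by (auto simp: is_path_def successively_Cons)
    then show ?thesis using Cons.IH by (meson converse_rtrancl_into_rtrancl)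
  qed (use Cons.prems in \<open>auto simp: is_path_def\<close>)
qed (simp add: is_path_def)

lemma relpow_imp_is_path:
  assumes "simple_graph G" "x \<in> gverts G" "(x, y) \<in> (adj G)\<^sup>= ^^ k"
  shows "\<exists>p. is_path G x p y \<and> length p \<le> Suc k"
  using assms(3)
proof (induction k arbitrary: y)
  case 0
  then have "is_path G x [x] y" using assms(2) by (simp add: is_path_def)
  then show ?case by fastforce
next
  case (Suc k)
  then obtain z where z: "(x, z) \<in> (adj G)\<^sup>= ^^ k" "z = y \<or> {z, y} \<in> gedges G" by auto
  obtain p where p: "is_path G x p z" "length p \<le> Suc k" using Suc.IH z(1) by blast
  consider "z = y" | "{z, y} \<in> gedges G" "y \<in> set p" | "{z, y} \<in> gedges G" "y \<notin> set p"
    using z(2) by blast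
  then show ?case
  proof cases
    case 1
    then show ?thesis using p by fastforce
  next
    case 2
    \<comment> \<open>If \<open>y\<close> already lies on the path, cutting the path at
      \<open>y\<close> keeps its vertices distinct.\<close>
    then obtain q r where "p = q @ y # r" by (meson split_list)
    then have "is_path G x (q @ [y]) y \<and> length (q @ [y]) \<le> Suc (Suc k)"
      using p by (cases q) (auto simp: is_path_def successively_append_iff successively_Cons hd_append)
    then show ?thesis by blast
  next
    case 3
    then have "is_path G x (p @ [y]) y"
      using p simple_graph_edgeD[OF assms(1) 3(1)]
      by (auto simp: is_path_def successively_append_iff)
    then show ?thesis using p by fastforce
  qed
qed

lemma relpow_2: "R ^^ 2 = R O R"
  by (simp add: numeral_2_eq_2)

text \<open>A witness that the radius is at most two. Joining any two vertices through the centre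
  bounds the diameter by 2 + 2.\<close>

definition two_centre :: "'a ugraph \<Rightarrow> 'a \<Rightarrow> bool" where
  "two_centre G a \<longleftrightarrow> a \<in> gverts G \<and> gverts G \<subseteq> ((adj G)\<^sup>= ^^ 2) `` {a}"

lemma two_centre_imp_diameter_le:
  assumes "simple_graph G" "two_centre G a"
  shows "graph_diameter G \<le> 4"
proof -
  have dist: "graph_dist G x y \<le> 4" if xy: "x \<in> gverts G" "y \<in> gverts G" for x y
  proof -
    have "(a, x) \<in> (adj G)\<^sup>= ^^ 2" "(a, y) \<in> (adj G)\<^sup>= ^^ 2"
      using assms(2) xy by (auto simp: two_centre_def)
    moreover have "sym ((adj G)\<^sup>= ^^ 2)"
      using sym_adj[of G] by (auto simp: sym_def relpow_2 relcomp_unfold)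
    ultimately have "(x, y) \<in> (adj G)\<^sup>= ^^ (2 + 2)"
      unfolding relpow_add by (meson relcompI symD)
    then have "(x, y) \<in> (adj G)\<^sup>= ^^ 4" by simp
    then obtain p where p: "is_path G x p y" "length p \<le> Suc 4"
      using relpow_imp_is_path[OF assms(1) xy(1)] by blast
    then have "length p = Suc (length p - 1)" by (auto simp: is_path_def)
    then have "graph_dist G x y \<le> length p - 1"
      unfolding graph_dist_def using p(1) by (intro Least_le) blast
    then show ?thesis using p(2) by simp
  qed
  have "{graph_dist G x y | x y. x \<in> gverts G \<and> y \<in> gverts G} \<subseteq> {..4}"
    using dist by auto
  \<comment> \<open>Nonemptiness matters because \<open>Max\<close> of the empty set is
    unspecified.\<close>
  moreover have "{graph_dist G x y | x y. x \<in> gverts G \<and> y \<in> gverts G} \<noteq> {}"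
    using assms(2) by (auto simp: two_centre_def)
  ultimately show ?thesis
    unfolding graph_diameter_def
    by (metis (no_types, lifting) Max_in atMost_iff finite_atMost finite_subset subsetD)
qed

section \<open>Transfer of connectivity and centres along isomorphisms\<close>

lemma graph_connected_rtrancl:
  "graph_connected G \<Longrightarrow> x \<in> gverts G \<Longrightarrow> y \<in> gverts G \<Longrightarrow> (x, y) \<in> (adj G)\<^sup>*"
  unfolding graph_connected_def using is_path_imp_rtrancl by metis

lemma isomorphic_rtrancl:
  assumes "simple_graph H" "graph_connected H" "graph_isomorphic H K"
    and "x \<in> gverts K" "y \<in> gverts K"
  shows "(x, y) \<in> (adj K)\<^sup>*"
proof -
  obtain f where f: "bij_betw f (gverts H) (gverts K)"
    and iso: "\<And>u v. u \<in> gverts H \<Longrightarrow> v \<in> gverts H \<Longrightarrow>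
      {u, v} \<in> gedges H \<longleftrightarrow> {f u, f v} \<in> gedges K"
    using assms(3) by (auto simp: graph_isomorphic_def)
  obtain a b where ab: "a \<in> gverts H" "b \<in> gverts H" "x = f a" "y = f b"
    using assms(4,5) unfolding bij_betw_imp_surj_on[OF f, symmetric] by blast
  have "(a, b) \<in> (adj H)\<^sup>*" using graph_connected_rtrancl assms(2) ab by metis
  then have "(f a, f b) \<in> (adj K)\<^sup>*"
  proof (induction rule: rtrancl_induct)
    case (step s t)
    then have "{s, t} \<in> gedges H" by simp
    then have "(f s, f t) \<in> adj K"
      using iso[of s t] simple_graph_edgeD(1,2)[OF assms(1), of s t] by simp
    then show ?case using step.IH by (meson rtrancl.rtrancl_into_rtrancl)
  qed simp
  then show ?thesis using ab by simp
qed

lemma isomorphic_two_centre: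
  assumes "simple_graph K" "graph_isomorphic H K" "two_centre K x"
  shows "\<exists>a. two_centre H a"
proof -
  obtain f where f: "bij_betw f (gverts H) (gverts K)"
    and iso: "\<And>u v. u \<in> gverts H \<Longrightarrow> v \<in> gverts H \<Longrightarrow>
      {u, v} \<in> gedges H \<longleftrightarrow> {f u, f v} \<in> gedges K"
    using assms(2) by (auto simp: graph_isomorphic_def)
  have "x \<in> f ` gverts H"
    using assms(3) bij_betw_imp_surj_on[OF f] by (simp add: two_centre_def)
  then obtain a where a: "a \<in> gverts H" "x = f a" by blast
  have step: "(s, t) \<in> (adj H)\<^sup>="
    if "(f s, f t) \<in> (adj K)\<^sup>=" "s \<in> gverts H" "t \<in> gverts H" for s t
    using that iso[of s t] inj_onD[OF bij_betw_imp_inj_on[OF f], of s t] by auto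
  have "(a, b) \<in> (adj H)\<^sup>= ^^ 2" if b: "b \<in> gverts H" for b
  proof -
    have "f b \<in> gverts K" using b f by (auto simp: bij_betw_def)
    then have "(f a, f b) \<in> (adj K)\<^sup>= ^^ 2"
      using assms(3) a by (auto simp: two_centre_def)
    then obtain z where z: "(f a, z) \<in> (adj K)\<^sup>=" "(z, f b) \<in> (adj K)\<^sup>="
      unfolding relpow_2 by (rule relcompE) simp
    \<comment> \<open>The middle vertex of the walk needs a preimage under \<open>f\<close>. It is
      either \<open>f b\<close> itself or an end of an edge of \<open>K\<close>.\<close>
    have "z \<in> gverts K"
      using z \<open>f b \<in> gverts K\<close> simple_graph_edgeD[OF assms(1)] by auto
    then have "z \<in> f ` gverts H" using bij_betw_imp_surj_on[OF f] by simp
    then obtain s where "s \<in> gverts H" "z = f s" by blast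
    then have "(a, s) \<in> (adj H)\<^sup>=" "(s, b) \<in> (adj H)\<^sup>="
      using step[of a s] step[of s b] z a b by blast+
    then show ?thesis unfolding relpow_2 by (rule relcompI)
  qed
  then show ?thesis using a by (auto simp: two_centre_def)
qed

section \<open>Pendant vertices\<close>

text \<open>Isolated vertices count as leaves.\<close>

definition leaf :: "'a ugraph \<Rightarrow> 'a \<Rightarrow> bool" where
  "leaf G x \<longleftrightarrow> (\<forall>s t. {x, s} \<in> gedges G \<and> {x, t} \<in> gedges G \<longrightarrow> s = t)"

text \<open>Isolated vertices, both ends of an isolated edge and the leaves of a star component
  satisfy this; the edge count relies on the first two cases.\<close>

definition pendant :: "'a ugraph \<Rightarrow> 'a \<Rightarrow> bool" where
  "pendant G u \<longleftrightarrow> leaf G u \<and>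
     (\<forall>s y z. {u, s} \<in> gedges G \<and> {s, y} \<in> gedges G \<and> {s, z} \<in> gedges G \<and>
        \<not> leaf G y \<and> \<not> leaf G z \<longrightarrow> y = z)"

section \<open>Counting edges\<close>

text \<open>If \<open>y\<close> has a leaf neighbour, that leaf is not pendant, and its only
  neighbour \<open>y\<close> must have two neighbours that are not leaves. Otherwise no neighbour of
  \<open>y\<close> is a leaf, and \<open>y\<close> has at least two neighbours.\<close>

lemma two_nonleaf_neighbours:
  assumes "\<And>x. {y, x} \<in> gedges G \<Longrightarrow> \<not> pendant G x" "\<not> leaf G y"
  obtains s t where "s \<noteq> t" "{y, s} \<in> gedges G" "{y, t} \<in> gedges G" "\<not> leaf G s" "\<not> leaf G t"
proof (cases "\<exists>x. {y, x} \<in> gedges G \<and> leaf G x")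
  case True
  then obtain x where x: "{y, x} \<in> gedges G" "leaf G x" by blast
  then obtain q s t where "{x, q} \<in> gedges G" "{q, s} \<in> gedges G" "{q, t} \<in> gedges G"
    "\<not> leaf G s" "\<not> leaf G t" "s \<noteq> t"
    using assms(1)[OF x(1)] by (auto simp: pendant_def)
  moreover from this x have "q = y" by (auto simp: leaf_def insert_commute)
  ultimately show ?thesis using that by blast
next
  case False
  then show ?thesis using assms(2) that unfolding leaf_def[of G y] by blast
qed

text \<open>After deleting the leaves every vertex still has degree at least two, and every
  deleted leaf takes its own edge with it.\<close>

lemma card_le_edges_of_no_pendant:
  assumes G: "simple_graph G" and W: "W \<subseteq> gverts G"
    and closed: "\<And>x y. x \<in> W \<Longrightarrow> {x, y} \<in> gedges G \<Longrightarrow> y \<in> W"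
    and np: "\<And>x. x \<in> W \<Longrightarrow> \<not> pendant G x"
  shows "card W \<le> card {e \<in> gedges G. e \<subseteq> W}"
proof -
  define L where "L = {x \<in> W. leaf G x}"
  define W' where "W' = W - L"
  define E' where "E' = {e \<in> gedges G. e \<subseteq> W'}"
  define EL where "EL = {e \<in> gedges G. e \<subseteq> W \<and> e \<inter> L \<noteq> {}}"
  have fin: "finite W" "finite L" "finite W'" "finite E'" "finite EL"
    using G W finite_gedges[OF G] finite_subset[of W "gverts G"]
    by (auto simp: L_def W'_def E'_def EL_def simple_graph_def)
  \<comment> \<open>Isolated vertices are pendant, so every leaf in \<open>W\<close> has an
    edge.\<close>
  have "\<exists>y. {x, y} \<in> gedges G" if "x \<in> L" for x
    using np[of x] that by (auto simp: L_def pendant_def leaf_def)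
  then obtain g where g: "\<And>x. x \<in> L \<Longrightarrow> {x, g x} \<in> gedges G" by metis
  have "inj_on (\<lambda>x. {x, g x}) L"
  proof (rule inj_onI)
    fix x y assume xy: "x \<in> L" "y \<in> L" "{x, g x} = {y, g y}"
    show "x = y"
    proof (rule ccontr)
      assume "x \<noteq> y"
      \<comment> \<open>Two leaves sharing their edge would form an isolated edge, whose ends are
        pendant.\<close>
      then have "g x = y" using xy(3) by (auto simp: doubleton_eq_iff)
      moreover have "leaf G x" "leaf G y" using xy by (auto simp: L_def)
      ultimately have "pendant G x"
        using g[OF xy(1)] unfolding pendant_def leaf_def by (metis insert_commute)
      then show False using np xy by (auto simp: L_def)
    qed
  qed
  moreover have "(\<lambda>x. {x, g x}) ` L \<subseteq> EL"
    using g closed by (auto simp: EL_def L_def)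
  ultimately have "card L \<le> card EL" using fin by (metis card_inj_on_le)
  have deg: "2 \<le> card {e \<in> E'. y \<in> e}" if y: "y \<in> W'" for y
  proof -
    have "\<not> leaf G y" "y \<in> W" using y by (auto simp: W'_def L_def)
    then obtain s t where st: "s \<noteq> t" "{y, s} \<in> gedges G" "{y, t} \<in> gedges G"
      "\<not> leaf G s" "\<not> leaf G t"
      using two_nonleaf_neighbours np closed by metis
    then have "{{y, s}, {y, t}} \<subseteq> {e \<in> E'. y \<in> e}"
      using closed \<open>y \<in> W\<close> y by (auto simp: E'_def W'_def L_def)
    then have "card {{y, s}, {y, t}} \<le> card {e \<in> E'. y \<in> e}"
      using fin by (intro card_mono) auto
    moreover have "{y, s} \<noteq> {y, t}" using st(1) by (auto simp: doubleton_eq_iff)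
    ultimately show ?thesis by simp
  qed
  have "card {y \<in> W'. y \<in> e} = 2" if "e \<in> E'" for e
  proof -
    have "e \<in> gedges G" using that by (simp add: E'_def)
    then obtain x y where "e = {x, y}" "x \<noteq> y" by (rule simple_graph_edgeE[OF G])
    moreover have "{y \<in> W'. y \<in> e} = e" using that by (auto simp: E'_def)
    ultimately show ?thesis by simp
  qed
  \<comment> \<open>Double counting of incidences: the degrees in \<open>W'\<close> sum to twice
    \<open>card E'\<close> and are all at least two.\<close>
  then have "(\<Sum>y\<in>W'. card {e \<in> E'. y \<in> e}) = (\<Sum>e\<in>E'. 2)"
    using fin by (intro sum_multicount_gen) auto
  moreover have "(\<Sum>y\<in>W'. 2) \<le> (\<Sum>y\<in>W'. card {e \<in> E'. y \<in> e})"
    by (rule sum_mono) (rule deg)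
  ultimately have "card W' \<le> card E'" by simp
  have "card W = card L + card W'"
    using fin by (subst card_Un_disjoint[symmetric]) (auto simp: W'_def L_def intro: arg_cong)
  also have "\<dots> \<le> card EL + card E'" using \<open>card L \<le> card EL\<close> \<open>card W' \<le> card E'\<close> by simp
  also have "\<dots> = card (EL \<union> E')"
    using fin by (subst card_Un_disjoint) (auto simp: EL_def E'_def W'_def)
  also have "\<dots> \<le> card {e \<in> gedges G. e \<subseteq> W}"
    using finite_gedges[OF G] by (intro card_mono) (auto simp: EL_def E'_def W'_def)
  finally show ?thesis .
qed

text \<open>A largest set \<open>S\<close> around \<open>r\<close> that satisfies the bound replaces
  a spanning tree. An edge leaving \<open>S\<close> would contribute one new vertex and at least one
  new edge, so \<open>S\<close> is closed under adjacency and equals \<open>C\<close>.\<close>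

lemma card_component_le:
  assumes G: "simple_graph G" and r: "r \<in> gverts G"
  defines "C \<equiv> (adj G)\<^sup>* `` {r}"
  shows "card C \<le> Suc (card {e \<in> gedges G. e \<subseteq> C})"
proof -
  have "x \<in> gverts G" if "(r, x) \<in> (adj G)\<^sup>*" for x
    using that r by (induction rule: rtrancl_induct) (auto dest: simple_graph_edgeD[OF G])
  then have finC: "finite C" using G finite_subset[of C "gverts G"]
    by (auto simp: C_def simple_graph_def)
  define P where "P S \<longleftrightarrow> r \<in> S \<and> S \<subseteq> C \<and> card S \<le> Suc (card {e \<in> gedges G. e \<subseteq> S})" for S
  have "P {r}" by (auto simp: P_def C_def)
  moreover have "\<forall>S. P S \<longrightarrow> card S < Suc (card C)"
    using finC by (auto simp: P_def less_Suc_eq_le intro: card_mono)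
  ultimately obtain S where S: "P S" and max: "\<And>T. P T \<Longrightarrow> card T \<le> card S"
    using ex_has_greatest_nat[of P "{r}" card] by blast
  have finS: "finite S" using S finC finite_subset by (auto simp: P_def)
  have step: "y \<in> S" if "x \<in> S" "{x, y} \<in> gedges G" for x y
  proof (rule ccontr)
    assume y: "y \<notin> S"
    have "(r, x) \<in> (adj G)\<^sup>*" using S that by (auto simp: P_def C_def)
    then have "y \<in> C" using that by (auto simp: C_def intro: rtrancl.rtrancl_into_rtrancl)
    have fin: "finite {e \<in> gedges G. e \<subseteq> T}" for T using finite_gedges[OF G] by simp
    have "Suc (card {e \<in> gedges G. e \<subseteq> S}) = card (insert {x, y} {e \<in> gedges G. e \<subseteq> S})"
      using y fin by simp
    also have "\<dots> \<le> card {e \<in> gedges G. e \<subseteq> insert y S}"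
      using that by (intro card_mono fin) auto
    finally have "P (insert y S)" using S y finS \<open>y \<in> C\<close> by (auto simp: P_def)
    then show False using max y finS by fastforce
  qed
  have "x \<in> S" if "(r, x) \<in> (adj G)\<^sup>*" for x
    using that S step by (induction rule: rtrancl_induct) (auto simp: P_def)
  then have "S = C" using S by (auto simp: P_def C_def)
  then show ?thesis using S by (simp add: P_def)
qed

text \<open>The component of one pendant vertex has at most one vertex more than edges. The rest
  \<open>W\<close> has no pendant vertex and so at least as many edges as vertices.\<close>

lemma card_le_Suc_edges:
  assumes G: "simple_graph G"
    and pend: "\<And>u v. u \<in> gverts G \<Longrightarrow> v \<in> gverts G \<Longrightarrow> pendant G u \<Longrightarrow> pendant G v \<Longrightarrow>
      (u, v) \<in> (adj G)\<^sup>*"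
  shows "card (gverts G) \<le> Suc (card (gedges G))"
proof (cases "\<exists>r \<in> gverts G. pendant G r")
  case True
  then obtain r where r: "r \<in> gverts G" "pendant G r" by blast
  define C where "C = (adj G)\<^sup>* `` {r}"
  define W where "W = gverts G - C"
  have fin: "finite (gverts G)" "finite (gedges G)"
    using G finite_gedges by (auto simp: simple_graph_def)
  have CV: "x \<in> gverts G" if "(r, x) \<in> (adj G)\<^sup>*" for x
    using that r by (induction rule: rtrancl_induct) (auto dest: simple_graph_edgeD[OF G])
  have "card W \<le> card {e \<in> gedges G. e \<subseteq> W}"
  proof (rule card_le_edges_of_no_pendant[OF G])
    fix x y assume xy: "x \<in> W" "{x, y} \<in> gedges G"
    have "y \<notin> C"
    proof
      assume "y \<in> C"
      moreover have "(y, x) \<in> adj G" using xy(2) by (simp add: insert_commute)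
      ultimately have "x \<in> C" unfolding C_def by (auto intro: rtrancl.rtrancl_into_rtrancl)
      then show False using xy by (simp add: W_def)
    qed
    then show "y \<in> W" using simple_graph_edgeD[OF G xy(2)] by (simp add: W_def)
  qed (use pend r in \<open>auto simp: W_def C_def\<close>)
  moreover have "card C \<le> Suc (card {e \<in> gedges G. e \<subseteq> C})"
    using card_component_le[OF G r(1)] by (simp add: C_def)
  moreover have "card (gverts G) = card C + card W"
  proof -
    have "C \<subseteq> gverts G" using CV by (auto simp: C_def)
    then show ?thesis using fin by (simp add: W_def card_Diff_subset finite_subset card_mono)
  qed
  moreover have "card {e \<in> gedges G. e \<subseteq> C} + card {e \<in> gedges G. e \<subseteq> W} \<le> card (gedges G)"
  proof -
    \<comment> \<open>The empty set would be counted on both sides; edges are not empty.\<close>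
    have "e \<noteq> {}" if "e \<in> gedges G" for e using that G by (auto elim: simple_graph_edgeE)
    then have "{e \<in> gedges G. e \<subseteq> C} \<inter> {e \<in> gedges G. e \<subseteq> W} = {}"
      unfolding W_def by blast
    then have "card {e \<in> gedges G. e \<subseteq> C} + card {e \<in> gedges G. e \<subseteq> W} =
        card ({e \<in> gedges G. e \<subseteq> C} \<union> {e \<in> gedges G. e \<subseteq> W})"
      using fin by (simp add: card_Un_disjoint)
    also have "\<dots> \<le> card (gedges G)" using fin by (intro card_mono) auto
    finally show ?thesis .
  qed
  ultimately show ?thesis by linarith
next
  case False
  then have "card (gverts G) \<le> card {e \<in> gedges G. e \<subseteq> gverts G}"
    by (intro card_le_edges_of_no_pendant[OF G]) (auto dest: simple_graph_edgeD[OF G])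
  also have "\<dots> \<le> card (gedges G)" using finite_gedges[OF G] by (intro card_mono) auto
  finally show ?thesis by simp
qed

section \<open>Joining two pendant vertices\<close>

text \<open>Here \<open>a\<close> is the colour at \<open>u\<close>, and \<open>b\<close> is the
  colour of the second edge of every walk \<open>u\<close>, \<open>s\<close>, \<open>y\<close>,
  \<open>z\<close> that does not turn back. Where such edges do not exist, the colours are free
  apart from being distinct, so all shapes of the component are treated alike.\<close>

definition pendant_colours ::
    "'a ugraph \<Rightarrow> ('a set \<Rightarrow> 'c) \<Rightarrow> 'a \<Rightarrow> 'c \<Rightarrow> 'c \<Rightarrow> bool" where
  "pendant_colours G c u a b \<longleftrightarrow> a \<noteq> b \<and> (\<forall>s. {u, s} \<in> gedges G \<longrightarrow> c {u, s} = a) \<and>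
     (\<forall>s y z. {u, s} \<in> gedges G \<and> {s, y} \<in> gedges G \<and> {y, z} \<in> gedges G \<and> y \<noteq> u \<and> z \<noteq> s \<longrightarrow>
        c {s, y} = b)"

lemma pendant_imp_pendant_colours:
  fixes c :: "'a set \<Rightarrow> nat"
  assumes "pendant G u" "proper_edge_colouring G c"
  shows "\<exists>a b. pendant_colours G c u a b"
proof (cases "\<exists>s y z. {u, s} \<in> gedges G \<and> {s, y} \<in> gedges G \<and> {y, z} \<in> gedges G \<and> y \<noteq> u \<and> z \<noteq> s")
  case True
  then obtain s y z where h: "{u, s} \<in> gedges G" "{s, y} \<in> gedges G" "{y, z} \<in> gedges G"
    "y \<noteq> u" "z \<noteq> s" by blast
  have s: "t = s" if "{u, t} \<in> gedges G" for t
    using assms(1) h(1) that unfolding pendant_def leaf_def by blast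
  \<comment> \<open>A neighbour of \<open>s\<close> from which a walk can go on is not a leaf, so
    pendancy of \<open>u\<close> leaves only one such neighbour.\<close>
  have nl: "\<not> leaf G x" if "{s, x} \<in> gedges G" "{x, w} \<in> gedges G" "w \<noteq> s" for x w
    using that unfolding leaf_def by (metis insert_commute)
  have y: "x = y" if "{s, x} \<in> gedges G" "{x, w} \<in> gedges G" "w \<noteq> s" for x w
    using assms(1) h(1,2) that nl[OF that] nl[OF h(2,3,5)] unfolding pendant_def by blast
  have "{u, s} \<noteq> {s, y}" using h(4) by (auto simp: doubleton_eq_iff)
  moreover have "{u, s} \<inter> {s, y} \<noteq> {}" by simp
  ultimately have "c {u, s} \<noteq> c {s, y}"
    using assms(2) h(1,2) unfolding proper_edge_colouring_def by metis
  then have "pendant_colours G c u (c {u, s}) (c {s, y})"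
    unfolding pendant_colours_def using s y by blast
  then show ?thesis by blast
next
  case False
  have "\<exists>a. \<forall>s. {u, s} \<in> gedges G \<longrightarrow> c {u, s} = a"
    using assms(1) unfolding pendant_def leaf_def by metis
  then obtain a where "\<forall>s. {u, s} \<in> gedges G \<longrightarrow> c {u, s} = a" by blast
  \<comment> \<open>No walk leaves the star, so any second colour other than \<open>a\<close> will
    do.\<close>
  then have "pendant_colours G c u a (Suc a)"
    unfolding pendant_colours_def using False by auto
  then show ?thesis by blast
qed

text \<open>To get farther than distance two from \<open>u\<close>, a walk in \<open>K\<close> must
  take a second edge of colour \<open>b\<close>, which the rainbow graph \<open>K\<close> has
  already spent on \<open>uv\<close>. The dead end at \<open>v\<close> keeps such walks off
  \<open>v\<close>, hence inside \<open>G\<close>.\<close>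

lemma two_centre_of_dead_end:
  assumes K: "is_subgraph K (add_edge G {u, v})" "rainbow c K"
    and conn: "\<And>x y. x \<in> gverts K \<Longrightarrow> y \<in> gverts K \<Longrightarrow> (x, y) \<in> (adj K)\<^sup>*"
    and uv: "{u, v} \<in> gedges K" "c {u, v} = b"
    and pc: "pendant_colours G c u a b"
    and dead: "\<And>x. {v, x} \<in> gedges K \<Longrightarrow> x = u"
  shows "two_centre K u"
proof -
  have sK: "simple_graph K" and inG: "\<And>e. e \<in> gedges K \<Longrightarrow> e \<noteq> {u, v} \<Longrightarrow> e \<in> gedges G"
    using K(1) by (auto simp: is_subgraph_def add_edge_def)
  note KE = simple_graph_edgeD[OF sK]
  \<comment> \<open>The ball of radius two around \<open>u\<close> is closed under adjacency in
    \<open>K\<close>; by connectivity it is all of \<open>K\<close>.\<close>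
  have closed: "(u, z) \<in> (adj K)\<^sup>= ^^ 2"
    if y: "(u, y) \<in> (adj K)\<^sup>= ^^ 2" and yz: "{y, z} \<in> gedges K" for y z
  proof -
    obtain s where s: "(u, s) \<in> (adj K)\<^sup>=" "(s, y) \<in> (adj K)\<^sup>="
      using y unfolding relpow_2 by (rule relcompE) simp
    show ?thesis
    proof (cases "y = u \<or> {u, y} \<in> gedges K \<or> z = s")
      case True
      then show ?thesis using yz s by (auto simp: relpow_2)
    next
      case False
      then have us: "{u, s} \<in> gedges K" and sy: "{s, y} \<in> gedges K"
        using s by auto
      have nv: "s \<noteq> v" "y \<noteq> v"
        using dead[of y] dead[of s] sy False us KE by (auto simp: insert_commute)
      then have "z \<noteq> v" using dead[of y] yz False by (auto simp: insert_commute)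
      with nv have ne: "{u, s} \<noteq> {u, v}" "{s, y} \<noteq> {u, v}" "{y, z} \<noteq> {u, v}"
        by (auto simp: doubleton_eq_iff)
      then have "c {s, y} = b"
        using pc inG us sy yz False unfolding pendant_colours_def by blast
      then show ?thesis
        using K(2) uv sy ne(2) unfolding rainbow_def inj_on_def by blast
    qed
  qed
  have "(u, x) \<in> (adj K)\<^sup>= ^^ 2" if "x \<in> gverts K" for x
  proof -
    have "(u, x) \<in> (adj K)\<^sup>*" using conn KE(1)[OF uv(1)] that by blast
    then show ?thesis
      by (induction rule: rtrancl_induct) (use closed in \<open>auto simp: relpow_2\<close>)
  qed
  then show ?thesis using KE(1)[OF uv(1)] by (auto simp: two_centre_def)
qed

text \<open>If \<open>K\<close> went on beyond both \<open>u\<close> and \<open>v\<close>, it would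
  contain two edges of colour \<open>a\<close>. So one of the two is a dead end, and the other is a
  centre.\<close>

lemma exists_two_centre:
  assumes K: "is_subgraph K (add_edge G {u, v})" "rainbow c K"
    and conn: "\<And>x y. x \<in> gverts K \<Longrightarrow> y \<in> gverts K \<Longrightarrow> (x, y) \<in> (adj K)\<^sup>*"
    and uv: "{u, v} \<in> gedges K" "c {u, v} = b"
    and pc: "pendant_colours G c u a b" "pendant_colours G c v a b"
    and nconn: "(u, v) \<notin> (adj G)\<^sup>*"
  shows "\<exists>x. two_centre K x"
proof (cases "\<forall>x. {v, x} \<in> gedges K \<longrightarrow> x = u")
  case True
  then show ?thesis using two_centre_of_dead_end[OF K conn uv pc(1)] by blast
next
  case False
  then obtain x where x: "{v, x} \<in> gedges K" "x \<noteq> u" by blast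
  have dead: "y = v" if y: "{u, y} \<in> gedges K" for y
  proof (rule ccontr)
    assume "y \<noteq> v"
    then have "{u, y} \<noteq> {u, v}" "{v, x} \<noteq> {u, v}" using x(2) by (auto simp: doubleton_eq_iff)
    then have G: "{u, y} \<in> gedges G" "{v, x} \<in> gedges G"
      using K(1) x(1) y by (auto simp: is_subgraph_def add_edge_def)
    then have "c {u, y} = c {v, x}" using pc by (simp add: pendant_colours_def)
    then have "{u, y} = {v, x}" using K(2) x(1) y by (simp add: rainbow_def inj_on_def)
    then have "u = v" using \<open>y \<noteq> v\<close> x(2) by (auto simp: doubleton_eq_iff)
    then show False using nconn by blast
  qed
  have "two_centre K v"
  proof (rule two_centre_of_dead_end[where v = u, OF _ K(2) conn _ _ pc(2)])
    show "is_subgraph K (add_edge G {v, u})" "{v, u} \<in> gedges K" "c {v, u} = b"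
      using K(1) uv by (simp_all add: insert_commute)
  qed (use dead in auto)
  then show ?thesis by blast
qed

section \<open>Recolouring one side of the new edge\<close>

lemma exists_permutation_two_points:
  assumes "a \<noteq> b" "a' \<noteq> b'"
  shows "\<exists>\<pi> :: 'c \<Rightarrow> 'c. inj \<pi> \<and> \<pi> a' = a \<and> \<pi> b' = b"
proof (intro exI conjI)
  \<comment> \<open>The first swap sends \<open>a'\<close> to \<open>a\<close>. The second moves the
    image of \<open>b'\<close> to \<open>b\<close> and fixes \<open>a\<close>, which differs from
    both points swapped.\<close>
  let ?\<pi> = "transpose (transpose a' a b') b \<circ> transpose a' a"
  show "inj ?\<pi>" by (intro inj_compose) (simp_all add: inj_transpose)
  show "?\<pi> a' = a" "?\<pi> b' = b" using assms by (auto simp: transpose_def)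
qed

text \<open>Permuting the colours outside the component of \<open>u\<close> is harmless in \<open>G\<close>, and lets the
  two ends of the new edge be coloured alike.\<close>

lemma saturated_imp_pendant_connected:
  fixes G :: "'a ugraph" and H :: "'b ugraph"
  assumes H: "simple_graph H" "graph_connected H" "graph_diameter H \<ge> 5"
    and sat: "properly_rainbow_saturated H G"
    and u: "u \<in> gverts G" "pendant G u" and v: "v \<in> gverts G" "pendant G v"
  shows "(u, v) \<in> (adj G)\<^sup>*"
proof (rule ccontr)
  assume nconn: "(u, v) \<notin> (adj G)\<^sup>*"
  define C where "C = (adj G)\<^sup>* `` {u}"
  have G: "simple_graph G" using sat by (simp add: properly_rainbow_saturated_def)
  obtain c :: "'a set \<Rightarrow> nat" where c: "proper_edge_colouring G c" "\<not> has_rainbow_copy c G H"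
    using sat by (auto simp: properly_rainbow_saturated_def)
  have uv: "u \<noteq> v" "{u, v} \<notin> gedges G"
    using nconn by (auto simp: adj_def)
  have closed: "x \<in> C \<longleftrightarrow> y \<in> C" if "{x, y} \<in> gedges G" for x y
  proof -
    have "(x, y) \<in> adj G" "(y, x) \<in> adj G" using that by (auto simp: insert_commute)
    then show ?thesis unfolding C_def by (auto intro: rtrancl.rtrancl_into_rtrancl)
  qed
  have inC: "u \<in> C" "v \<notin> C" using nconn by (auto simp: C_def)
  obtain a b where ab: "pendant_colours G c u a b"
    using pendant_imp_pendant_colours[OF u(2) c(1)] by blast
  obtain a' b' where ab': "pendant_colours G c v a' b'"
    using pendant_imp_pendant_colours[OF v(2) c(1)] by blast
  obtain \<pi> :: "nat \<Rightarrow> nat" where p: "inj \<pi>" "\<pi> a' = a" "\<pi> b' = b"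
    using exists_permutation_two_points ab ab' unfolding pendant_colours_def by metis
  define d where "d e = (if e = {u, v} then b else if e \<subseteq> C then c e else \<pi> (c e))" for e
  have dC: "d {x, y} = c {x, y}" if "{x, y} \<in> gedges G" "x \<in> C" for x y
    using that uv closed by (auto simp: d_def)
  have dN: "d {x, y} = \<pi> (c {x, y})" if "{x, y} \<in> gedges G" "x \<notin> C" for x y
    using that uv closed by (auto simp: d_def)
  have pcu: "pendant_colours G d u a b"
    unfolding pendant_colours_def
  proof (intro conjI allI impI)
    show "a \<noteq> b" using ab by (simp add: pendant_colours_def)
    show "d {u, s} = a" if "{u, s} \<in> gedges G" for s
      using that ab dC inC by (simp add: pendant_colours_def)
    show "d {s, y} = b" if h: "{u, s} \<in> gedges G \<and> {s, y} \<in> gedges G \<and> {y, z} \<in> gedges G \<and>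
      y \<noteq> u \<and> z \<noteq> s" for s y z
    proof -
      have "c {s, y} = b" using h ab unfolding pendant_colours_def by blast
      then show ?thesis using h dC[of s y] closed[of u s] inC by simp
    qed
  qed
  have pcv: "pendant_colours G d v a b"
    unfolding pendant_colours_def
  proof (intro conjI allI impI)
    show "a \<noteq> b" using ab by (simp add: pendant_colours_def)
    show "d {v, s} = a" if "{v, s} \<in> gedges G" for s
      using that ab' dN[of v s] p inC by (simp add: pendant_colours_def)
    show "d {s, y} = b" if h: "{v, s} \<in> gedges G \<and> {s, y} \<in> gedges G \<and> {y, z} \<in> gedges G \<and>
      y \<noteq> v \<and> z \<noteq> s" for s y z
    proof -
      have "c {s, y} = b'" using h ab' unfolding pendant_colours_def by blast
      then show ?thesis using h dN[of s y] closed[of v s] inC p by simp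
    qed
  qed
  \<comment> \<open>Edges sharing \<open>x\<close> lie on the same side of \<open>C\<close>, where
    \<open>d\<close> is either \<open>c\<close> or \<open>c\<close> followed by the injection
    \<open>\<pi>\<close>.\<close>
  have dG: "d e \<noteq> d f"
    if ef: "e \<in> gedges G" "f \<in> gedges G" "e \<noteq> f" "x \<in> e" "x \<in> f" for e f x
  proof -
    obtain y where y: "e = {x, y}"
      using ef(4) by (rule_tac simple_graph_edgeE[OF G ef(1)]) auto
    obtain z where z: "f = {x, z}"
      using ef(5) by (rule_tac simple_graph_edgeE[OF G ef(2)]) auto
    have "c e \<noteq> c f" using c(1) ef unfolding proper_edge_colouring_def by blast
    then show ?thesis
      using ef dC[of x y] dC[of x z] dN[of x y] dN[of x z] p(1)
      unfolding y z by (cases "x \<in> C") (auto simp: inj_eq)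
  qed
  \<comment> \<open>Old edges at \<open>u\<close> or \<open>v\<close> have colour \<open>a\<close>,
    so colour \<open>b\<close> on the new edge clashes with none of them.\<close>
  have dnew: "d e \<noteq> b" if e: "e \<in> gedges G" "x \<in> e" "x = u \<or> x = v" for e x
  proof -
    obtain y where "e = {x, y}"
      using e(2) by (rule_tac simple_graph_edgeE[OF G e(1)]) auto
    then show ?thesis using e pcu pcv by (auto simp: pendant_colours_def)
  qed
  have duv: "d {u, v} = b" by (simp add: d_def)
  have "proper_edge_colouring (add_edge G {u, v}) d"
    unfolding proper_edge_colouring_def
  proof (intro ballI impI)
    fix e f assume e: "e \<in> gedges (add_edge G {u, v})" and f: "f \<in> gedges (add_edge G {u, v})"
      and ef: "e \<noteq> f \<and> e \<inter> f \<noteq> {}"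
    then obtain x where x: "x \<in> e" "x \<in> f" by blast
    show "d e \<noteq> d f"
    proof (cases "e = {u, v} \<or> f = {u, v}")
      case True
      then show ?thesis
        using e f ef x dnew[of e x] dnew[of f x] duv by (auto simp: add_edge_def)
    next
      case False
      then show ?thesis using e f ef x dG[of e f x] by (auto simp: add_edge_def)
    qed
  qed
  then have "has_rainbow_copy d (add_edge G {u, v}) H"
    using sat u v uv by (simp add: properly_rainbow_saturated_def)
  then obtain K where K: "is_subgraph K (add_edge G {u, v})" "graph_isomorphic H K" "rainbow d K"
    by (auto simp: has_rainbow_copy_def)
  have sK: "simple_graph K" using K(1) by (simp add: is_subgraph_def)
  have conn: "(x, y) \<in> (adj K)\<^sup>*" if "x \<in> gverts K" "y \<in> gverts K" for x y
    using isomorphic_rtrancl[OF H(1,2) K(2) that] .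
  show False
  proof (cases "{u, v} \<in> gedges K")
    case True
    obtain x where "two_centre K x"
      using exists_two_centre[OF K(1,3) conn True duv pcu pcv nconn] by blast
    then obtain h where "two_centre H h" using isomorphic_two_centre[OF sK K(2)] by blast
    then show False using two_centre_imp_diameter_le[OF H(1)] H(3) by fastforce
  next
    case False
    then have KG: "is_subgraph K G" using K(1) by (auto simp: is_subgraph_def add_edge_def)
    \<comment> \<open>A copy avoiding \<open>uv\<close> is connected inside \<open>G\<close> and
      stays on one side of \<open>C\<close>. There \<open>d\<close> is a function of
      \<open>c\<close>, so equal colours under \<open>c\<close> stay equal under \<open>d\<close>,
      and the copy is rainbow for \<open>c\<close> too.\<close>
    have side: "x \<in> C \<longleftrightarrow> y \<in> C" if "(x, y) \<in> (adj K)\<^sup>*" for x y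
      using that by (induction rule: rtrancl_induct)
        (use KG closed in \<open>auto simp: is_subgraph_def\<close>)
    have "inj_on c (gedges K)"
    proof (rule inj_onI)
      fix e f assume e: "e \<in> gedges K" and f: "f \<in> gedges K" and ef: "c e = c f"
      obtain x y where xy: "e = {x, y}" "x \<in> gverts K" by (rule simple_graph_edgeE[OF sK e])
      obtain z w where zw: "f = {z, w}" "z \<in> gverts K" by (rule simple_graph_edgeE[OF sK f])
      have "x \<in> C \<longleftrightarrow> z \<in> C" using side conn xy(2) zw(2) by blast
      moreover have "e \<in> gedges G" "f \<in> gedges G" using KG e f by (auto simp: is_subgraph_def)
      ultimately have "d e = d f"
        using ef dC[of x y] dC[of z w] dN[of x y] dN[of z w] unfolding xy(1) zw(1) by metis
      then show "e = f" using K(3) e f by (simp add: rainbow_def inj_on_def)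
    qed
    then have "has_rainbow_copy c G H"
      using KG K(2) by (auto simp: has_rainbow_copy_def rainbow_def)
    then show False using c(2) by simp
  qed
qed

section \<open>Existence of saturated graphs\<close>

text \<open>Ensures that the \<open>LEAST\<close> in \<open>sat_star\<close> is attained; without a
  witness its value would be unspecified.\<close>

lemma exists_saturated:
  fixes H :: "'a ugraph"
  assumes H: "simple_graph H" "gedges H \<noteq> {}"
  shows "\<exists>G :: nat ugraph. properly_rainbow_saturated H G \<and> card (gverts G) = n"
proof -
  define P where "P G \<longleftrightarrow> simple_graph G \<and> gverts G = {..<n} \<and>
    (\<exists>c :: nat set \<Rightarrow> nat. proper_edge_colouring G c \<and> \<not> has_rainbow_copy c G H)" for G
  obtain x y where xy: "{x, y} \<in> gedges H" "x \<in> gverts H" "y \<in> gverts H"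
    using H by (metis equals0I simple_graph_edgeE)
  \<comment> \<open>The edgeless graph starts the maximisation: it contains no copy of
    \<open>H\<close>, which has an edge.\<close>
  have "\<not> has_rainbow_copy c (Graph {..<n} {}) H" for c :: "nat set \<Rightarrow> nat"
    using xy by (auto simp: has_rainbow_copy_def is_subgraph_def graph_isomorphic_def)
  then have "P (Graph {..<n} {})"
    by (auto simp: P_def simple_graph_def proper_edge_colouring_def)
  moreover have "card (gedges G) < Suc (card (Pow {..<n}))" if "P G" for G
  proof -
    have "gedges G \<subseteq> Pow {..<n}" using that by (fastforce simp: P_def simple_graph_def)
    then show ?thesis by (simp only: less_Suc_eq_le) (intro card_mono, auto)
  qed
  ultimately obtain G where G: "P G" and max: "\<And>G'. P G' \<Longrightarrow> card (gedges G') \<le> card (gedges G)"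
    using ex_has_greatest_nat[of P "Graph {..<n} {}" "\<lambda>G. card (gedges G)"] by blast
  have sG: "simple_graph G" using G by (simp add: P_def)
  have "has_rainbow_copy c (add_edge G {u, v}) H"
    if uv: "u \<in> gverts G" "v \<in> gverts G" "u \<noteq> v" "{u, v} \<notin> gedges G"
      and c: "proper_edge_colouring (add_edge G {u, v}) c" for u v and c :: "nat set \<Rightarrow> nat"
  proof (rule ccontr)
    assume "\<not> has_rainbow_copy c (add_edge G {u, v}) H"
    then have "P (add_edge G {u, v})"
      using G c simple_graph_add_edge[OF sG uv(1-3)] by (auto simp: P_def add_edge_def)
    then have "card (gedges (add_edge G {u, v})) \<le> card (gedges G)" by (rule max)
    then show False using uv(4) finite_gedges[OF sG] by (simp add: add_edge_def)
  qed
  then have "properly_rainbow_saturated H G"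
    using G by (auto simp: properly_rainbow_saturated_def P_def)
  then show ?thesis using G by (auto simp: P_def)
qed

theorem theorem1p1:
  fixes H :: "'a ugraph" and n :: nat
  assumes "simple_graph H"
    and "graph_connected H"
    and "graph_diameter H \<ge> 5"
  shows "int (sat_star n H) \<ge> int n - 1"
proof -
  \<comment> \<open>A connected graph without edges is a single vertex, far below diameter
    five.\<close>
  have "gedges H \<noteq> {}"
  proof
    assume "gedges H = {}"
    then have adj: "adj H = {}" by (simp add: adj_def)
    obtain a where "a \<in> gverts H" using assms(2) by (auto simp: graph_connected_def)
    moreover have "gverts H \<subseteq> {a}"
      using graph_connected_rtrancl[OF assms(2) \<open>a \<in> gverts H\<close>] adj by auto
    ultimately have "two_centre H a" by (auto simp: two_centre_def relpow_2)
    then show False using two_centre_imp_diameter_le[OF assms(1)] assms(3) by fastforce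
  qed
  then have "\<exists>m. \<exists>G :: nat ugraph.
      properly_rainbow_saturated H G \<and> card (gverts G) = n \<and> card (gedges G) = m"
    using exists_saturated[OF assms(1)] by blast
  then have "\<exists>G :: nat ugraph.
      properly_rainbow_saturated H G \<and> card (gverts G) = n \<and> card (gedges G) = sat_star n H"
    unfolding sat_star_def by (rule LeastI_ex)
  then obtain G :: "nat ugraph" where G: "properly_rainbow_saturated H G"
    "card (gverts G) = n" "card (gedges G) = sat_star n H" by blast
  have "card (gverts G) \<le> Suc (card (gedges G))"
    using G(1) saturated_imp_pendant_connected[OF assms G(1)]
    by (intro card_le_Suc_edges) (auto simp: properly_rainbow_saturated_def)
  then show ?thesis using G by simp
qed

end
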